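(* Let $\mathcal{A}$ be a (complex) $C^*$-algebra and let $a, b \in \mathcal{A}$ with $a \neq 0$. Then $a$ is Birkhoff-James orthogonal to $b$ (that is, $\|a + \lambda b\| \geq \|a\|$ for all $\lambda \in \mathbb{C}$) if and only if there exists a bilinear map $\psi : \mathcal{A} \oplus_{\infty} \mathcal{A} \rightarrow \mathbb{C}$ such that $\|\psi\| = 1$, $\psi(a, a^* ) = \|a\|^2$ and $\psi(a, b^* ) = 0$.
   Context: For Banach spaces $X$ and $Y$, $X \oplus_{\infty} Y$ denotes the Banach space $X \times Y$ with the norm $\|(x,y)\|_{\infty} = \max\{\|x\|_X, \|y\|_Y\}$. A bilinear map $\psi : \mathcal{A} \oplus_{\infty} \mathcal{A} \rightarrow \mathbb{C}$ is a map on $\mathcal{A} \times \mathcal{A}$ that is $\mathbb{C}$-linear in each variable separately, and its norm is $\|\psi\| = \sup\{|\psi(u,v)| : u, v \in \mathcal{A}, \|u\| \leq 1, \|v\| \leq 1\}$. *)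

theory Defs
  imports "HOL-Analysis.Analysis"
begin

text \<open>
  The library's normed-space classes are real. The complex ones are obtained by adding a complex
  scalar multiplication that extends the real one.
\<close>

class complex_vector = real_vector +
  fixes scaleC :: "complex \<Rightarrow> 'a \<Rightarrow> 'a" (infixr "*\<^sub>C" 75)
  assumes scaleC_add_right: "c *\<^sub>C (x + y) = c *\<^sub>C x + c *\<^sub>C y"
    and scaleC_add_left: "(c + d) *\<^sub>C x = c *\<^sub>C x + d *\<^sub>C x"
    and scaleC_scaleC: "c *\<^sub>C (d *\<^sub>C x) = (c * d) *\<^sub>C x"
    and scaleC_of_real: "complex_of_real r *\<^sub>C x = r *\<^sub>R x"

class complex_normed_vector = complex_vector + real_normed_vector +
  assumes norm_scaleC: "norm (c *\<^sub>C x) = cmod c * norm x"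

text \<open>
  No unit is assumed: \<^class>\<open>real_normed_algebra\<close> provides an associative multiplication and a
  submultiplicative norm only.
\<close>

class cstar_algebra = complex_normed_vector + real_normed_algebra + banach +
  fixes star :: "'a \<Rightarrow> 'a"
  assumes mult_scaleC_left: "(c *\<^sub>C x) * y = c *\<^sub>C (x * y)"
    and mult_scaleC_right: "x * (c *\<^sub>C y) = c *\<^sub>C (x * y)"
    and star_add: "star (x + y) = star x + star y"
    and star_scaleC: "star (c *\<^sub>C x) = cnj c *\<^sub>C star x"
    and star_mult: "star (x * y) = star y * star x"
    and star_star: "star (star x) = x"
    and cstar_identity: "norm (star x * x) = (norm x)\<^sup>2"

definition birkhoff_james_orthogonal :: "'a::complex_normed_vector \<Rightarrow> 'a \<Rightarrow> bool" where
  "birkhoff_james_orthogonal a b \<longleftrightarrow> (\<forall>l::complex. norm (a + l *\<^sub>C b) \<ge> norm a)"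

definition complex_bilinear :: "('a::complex_vector \<times> 'a \<Rightarrow> complex) \<Rightarrow> bool" where
  "complex_bilinear \<psi> \<longleftrightarrow>
     (\<forall>v. Vector_Spaces.linear scaleC (*) (\<lambda>u. \<psi> (u, v))) \<and>
     (\<forall>u. Vector_Spaces.linear scaleC (*) (\<lambda>v. \<psi> (u, v)))"

text \<open>
  The supremum is over the unit ball of the maximum norm on the product, not of the Euclidean product
  norm of the library. It is taken in the extended reals, so an unbounded \<open>\<psi>\<close> has norm \<open>\<infinity>\<close>.
\<close>

definition bilinear_norm :: "('a::complex_normed_vector \<times> 'a \<Rightarrow> complex) \<Rightarrow> ereal" where
  "bilinear_norm \<psi> = (SUP (u, v) \<in> {(u, v). norm u \<le> 1 \<and> norm v \<le> 1}. ereal (cmod (\<psi> (u, v))))"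

end

theory Submission
  imports Defs
begin

text \<open>
  If \<open>a\<close> is Birkhoff-James orthogonal to \<open>b\<close>, the distance to the line \<open>\<complex> b\<close> is a seminorm below the
  norm that takes the value \<open>\<parallel>a\<parallel>\<close> at \<open>a\<close>. The Hahn-Banach theorem yields a complex functional \<open>f\<close>
  of norm one with \<open>f a = \<parallel>a\<parallel>\<close> and \<open>f b = 0\<close>, and \<open>\<psi> (u, v) = f u * cnj (f (star v))\<close> is the form
  wanted. Conversely, evaluating \<open>\<psi>\<close> at \<open>(a, star (a + \<lambda> b))\<close> gives
  \<open>\<parallel>a\<parallel>\<^sup>2 \<le> \<parallel>a\<parallel> * \<parallel>a + \<lambda> b\<parallel>\<close>.

  The Hahn-Banach theorem is obtained from the fact that the minimal sublinear functionals are the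
  linear ones.
\<close>

section \<open>Sublinear functionals and the real Hahn-Banach theorem\<close>

definition sublinear :: "('a::real_vector \<Rightarrow> real) \<Rightarrow> bool" where
  "sublinear p \<longleftrightarrow> (\<forall>x y. p (x + y) \<le> p x + p y) \<and> (\<forall>t\<ge>0. \<forall>x. p (t *\<^sub>R x) = t * p x)"

lemma sublinear_add: "sublinear p \<Longrightarrow> p (x + y) \<le> p x + p y"
  and sublinear_scaleR: "sublinear p \<Longrightarrow> 0 \<le> t \<Longrightarrow> p (t *\<^sub>R x) = t * p x"
  by (auto simp: sublinear_def)

lemma sublinear_zero: "sublinear p \<Longrightarrow> p 0 = 0"
  using sublinear_scaleR[of p 0 0] by simp

lemma sublinear_minus_ge: "sublinear p \<Longrightarrow> - p (- x) \<le> p x"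
  using sublinear_add[of p x "- x"] sublinear_zero[of p] by simp

text \<open>Directedness in place of convexity: for an approximate minimiser \<open>i\<close> at
  \<open>x\<close> and \<open>j\<close> at \<open>y\<close>, a single index \<open>k\<close> serves
  the sum. The lemma covers the three infima below: over \<open>t\<close>, over a chain of
  functionals, and over a complex line.\<close>

lemma sublinear_INF:
  fixes F :: "'i \<Rightarrow> 'a::real_vector \<Rightarrow> real"
  assumes "I \<noteq> {}"
    and bdd: "\<And>x. bdd_below ((\<lambda>i. F i x) ` I)"
    and add: "\<And>i j x y. i \<in> I \<Longrightarrow> j \<in> I \<Longrightarrow> \<exists>k\<in>I. F k (x + y) \<le> F i x + F j y"
    and scale: "\<And>i r x. i \<in> I \<Longrightarrow> 0 < r \<Longrightarrow> \<exists>k\<in>I. F k (r *\<^sub>R x) \<le> r * F i x"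
  shows "sublinear (\<lambda>x. INF i\<in>I. F i x)"
proof -
  define P where "P = (\<lambda>x. INF i\<in>I. F i x)"
  have lower: "P x \<le> F i x" if "i \<in> I" for i x
    unfolding P_def using that bdd by (rule cINF_lower[rotated])
  have greatest: "m \<le> P x" if "\<And>i. i \<in> I \<Longrightarrow> m \<le> F i x" for m x
    unfolding P_def using assms(1) that by (rule cINF_greatest)
  have P_add: "P (x + y) \<le> P x + P y" for x y
  proof -
    have "P (x + y) \<le> F i x + F j y" if "i \<in> I" "j \<in> I" for i j
      using add[OF that, of x y] lower order_trans by blast
    then have "P (x + y) - F i x \<le> P y" if "i \<in> I" for i
      using that by (intro greatest) (metis diff_le_eq add.commute)
    then have "P (x + y) - P y \<le> P x"
      by (intro greatest) (simp add: diff_le_eq add.commute)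
    then show ?thesis by simp
  qed
  have P_scale_le: "P (r *\<^sub>R x) \<le> r * P x" if "0 < r" for r x
  proof -
    have "P (r *\<^sub>R x) \<le> r * F i x" if "i \<in> I" for i
      using scale[OF that \<open>0 < r\<close>, of x] lower order_trans by blast
    then have "P (r *\<^sub>R x) / r \<le> P x"
      using that by (intro greatest) (simp add: field_simps)
    then show ?thesis using that by (simp add: field_simps)
  qed
  \<comment> \<open>The reverse inequality is the same bound for \<open>inverse r\<close> at the
    point \<open>r *\<^sub>R x\<close>.\<close>
  have P_scale: "P (r *\<^sub>R x) = r * P x" if "0 < r" for r x
    using P_scale_le[OF that, of x] P_scale_le[of "inverse r" "r *\<^sub>R x"] that
    by (simp add: field_simps)
  have "P 0 = 0"
    using P_scale[of 2 0] by simp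
  then have "P (r *\<^sub>R x) = r * P x" if "0 \<le> r" for r x
    using P_scale that by (cases "r = 0") auto
  then show ?thesis
    using P_add by (auto simp: sublinear_def P_def)
qed

text \<open>The witness is \<open>q x = (INF t\<in>{0..}. p (x + t *\<^sub>R y) - t * p y)\<close>.\<close>

lemma sublinear_decrease:
  fixes p :: "'a::real_vector \<Rightarrow> real"
  assumes p: "sublinear p"
  obtains q where "sublinear q" "q \<le> p" "\<And>x. q x \<le> p (x + y) - p y"
proof -
  define F where "F = (\<lambda>t x. p (x + t *\<^sub>R y) - t * p y)"
  have bdd: "bdd_below ((\<lambda>t. F t x) ` {0..})" for x
  proof (rule bdd_belowI2)
    fix t :: real assume "t \<in> {0..}"
    \<comment> \<open>Finiteness of the infimum: \<open>t * p y\<close> is \<open>p\<close> of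
      \<open>(x + t *\<^sub>R y) + (- x)\<close>, hence at most
      \<open>p (x + t *\<^sub>R y) + p (- x)\<close>.\<close>
    then show "- p (- x) \<le> F t x"
      using sublinear_add[OF p, of "x + t *\<^sub>R y" "- x"] sublinear_scaleR[OF p, of t y]
      by (simp add: F_def)
  qed
  have add: "\<exists>k\<in>{0..}. F k (u + v) \<le> F s u + F t v" if "s \<in> {0..}" "t \<in> {0..}" for s t u v
    using that sublinear_add[OF p, of "u + s *\<^sub>R y" "v + t *\<^sub>R y"]
    by (intro bexI[of _ "s + t"]) (auto simp: F_def algebra_simps)
  have scale: "\<exists>k\<in>{0..}. F k (r *\<^sub>R u) \<le> r * F t u" if "t \<in> {0..}" "0 < r" for t r u
    using that sublinear_scaleR[OF p, of r "u + t *\<^sub>R y"]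
    by (intro bexI[of _ "r * t"]) (auto simp: F_def algebra_simps)
  define q where "q = (\<lambda>x. INF t\<in>{0..}. F t x)"
  have q_le: "q x \<le> F t x" if "0 \<le> t" for x t
    unfolding q_def using that by (intro cINF_lower bdd) simp
  show thesis
  proof
    show "sublinear q"
      unfolding q_def using bdd add scale by (intro sublinear_INF) auto
    show "q \<le> p"
      using q_le[of 0] by (simp add: le_fun_def F_def)
    show "q x \<le> p (x + y) - p y" for x
      using q_le[of 1 x] by (simp add: F_def)
  qed
qed

text \<open>Decreasing \<open>p\<close> in the direction \<open>y\<close> cannot change it, so the
  bound on \<open>q\<close> becomes superadditivity of \<open>p\<close>. Additivity then gives
  oddness, and oddness gives the negative scalars.\<close>

lemma minimal_sublinear_imp_linear:
  fixes p :: "'a::real_vector \<Rightarrow> real"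
  assumes p: "sublinear p" and min: "\<And>q. sublinear q \<Longrightarrow> q \<le> p \<Longrightarrow> q = p"
  shows "linear p"
proof -
  have add: "p (x + y) = p x + p y" for x y
  proof -
    obtain q where "sublinear q" "q \<le> p" "\<And>x. q x \<le> p (x + y) - p y"
      using sublinear_decrease[OF p] by blast
    then have "p x \<le> p (x + y) - p y"
      using min by metis
    then show ?thesis
      using sublinear_add[OF p, of x y] by simp
  qed
  have minus: "p (- x) = - p x" for x
    using add[of x "- x"] sublinear_zero[OF p] by simp
  have "p (r *\<^sub>R x) = r * p x" for r x
    using sublinear_scaleR[OF p, of r x] sublinear_scaleR[OF p, of "- r" x] minus[of "r *\<^sub>R x"]
    by (cases "0 \<le> r") auto
  then show ?thesis
    using add by (intro linearI) auto
qed

text \<open>Zorn's lemma, with the pointwise infimum as lower bound of a nonempty chain. It is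
  finite because every sublinear \<open>q\<close> below \<open>p\<close> satisfies
  \<open>q x \<ge> - q (- x) \<ge> - p (- x)\<close>.\<close>

lemma minimal_sublinear_exists:
  fixes p :: "'a::real_vector \<Rightarrow> real"
  assumes p: "sublinear p"
  obtains m where "sublinear m" "m \<le> p" "\<And>q. sublinear q \<Longrightarrow> q \<le> m \<Longrightarrow> q = m"
proof -
  define A where "A = {q. sublinear q \<and> q \<le> p}"
  \<comment> \<open>The order is reversed, so that a maximal element in Zorn's lemma is a minimal
    functional.\<close>
  define R where "R = relation_of (\<ge>) A"
  have "partial_order_on A R"
    unfolding R_def by (rule partial_order_on_relation_ofI) auto
  moreover have "\<exists>u\<in>A. \<forall>q\<in>C. u \<le> q" if C: "C \<in> Chains R" for C
  proof (cases "C = {}")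
    case True
    then show ?thesis using p by (auto simp: A_def)
  next
    case False
    have sub: "sublinear q" "q \<le> p" if "q \<in> C" for q
      using that C by (auto simp: Chains_def R_def relation_of_def A_def)
    have chain: "q \<le> r \<or> r \<le> q" if "q \<in> C" "r \<in> C" for q r
      using that C by (auto simp: Chains_def R_def relation_of_def)
    have bdd: "bdd_below ((\<lambda>q. q x) ` C)" for x
    proof (rule bdd_belowI2)
      fix q assume "q \<in> C"
      then show "- p (- x) \<le> q x"
        using sub[of q] sublinear_minus_ge[of q x] le_funD[of q p "- x"] by simp
    qed
    define u where "u = (\<lambda>x. INF q\<in>C. q x)"
    have "sublinear u"
      unfolding u_def
    proof (rule sublinear_INF[OF False bdd])
      fix q r x y assume qr: "q \<in> C" "r \<in> C"
      from chain[OF this] show "\<exists>k\<in>C. k (x + y) \<le> q x + r y"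
      proof
        assume "q \<le> r"
        then show ?thesis
          using qr sublinear_add[OF sub(1), of q x y] le_funD[of q r y] by (intro bexI[of _ q]) auto
      next
        assume "r \<le> q"
        then show ?thesis
          using qr sublinear_add[OF sub(1), of r x y] le_funD[of r q x] by (intro bexI[of _ r]) auto
      qed
    next
      fix q x and r :: real assume "q \<in> C" "0 < r"
      then show "\<exists>k\<in>C. k (r *\<^sub>R x) \<le> r * q x"
        using sublinear_scaleR[OF sub(1), of q r x] by (intro bexI[of _ q]) auto
    qed
    moreover have u_le: "u \<le> q" if "q \<in> C" for q
      unfolding u_def le_fun_def using that bdd by (auto intro: cINF_lower)
    moreover have "u \<le> p"
      using False u_le sub(2) order_trans by blast
    ultimately show ?thesis by (auto simp: A_def)
  qed
  ultimately obtain m where "m \<in> A" and m: "\<And>q. q \<in> A \<Longrightarrow> q \<le> m \<Longrightarrow> q = m"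
    using predicate_Zorn[of A "(\<ge>)"] unfolding R_def by blast
  show thesis
  proof
    show "sublinear m" "m \<le> p" using \<open>m \<in> A\<close> by (auto simp: A_def)
    then show "q = m" if "sublinear q" "q \<le> m" for q
      using that m[of q] by (auto simp: A_def)
  qed
qed

text \<open>A minimal functional below \<open>p\<close> need not touch \<open>p\<close> at
  \<open>a\<close>. Decreasing \<open>p\<close> in the direction \<open>a\<close> first forces
  \<open>q (- a) \<le> p 0 - p a = - p a\<close>, and a linear \<open>g\<close> below
  \<open>q\<close> then has \<open>g a \<ge> p a\<close>.\<close>

theorem hahn_banach_sublinear:
  fixes p :: "'a::real_vector \<Rightarrow> real"
  assumes "sublinear p"
  obtains g where "linear g" "\<And>x. g x \<le> p x" "g a = p a"
proof -
  obtain q where q: "sublinear q" "q \<le> p" "\<And>x. q x \<le> p (x + a) - p a"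
    using sublinear_decrease[OF assms] by blast
  obtain g where g: "sublinear g" "g \<le> q" "\<And>r. sublinear r \<Longrightarrow> r \<le> g \<Longrightarrow> r = g"
    using minimal_sublinear_exists[OF q(1)] by blast
  have lin: "linear g"
    using g by (intro minimal_sublinear_imp_linear) auto
  have le: "g x \<le> p x" for x
    using g(2) q(2) by (metis le_funD order_trans)
  have "g (- a) \<le> - p a"
    using le_funD[OF g(2), of "- a"] q(3)[of "- a"] sublinear_zero[OF assms] by simp
  then have "g a = p a"
    using le[of a] linear_neg[OF lin, of a] by simp
  with lin le show thesis using that by blast
qed

section \<open>Complex scalars and the norming functional\<close>

lemma scaleC_one [simp]: "1 *\<^sub>C x = x"
  using scaleC_of_real[of 1 x] by simp

lemma vector_space_scaleC: "vector_space (scaleC :: complex \<Rightarrow> 'a \<Rightarrow> 'a::complex_vector)"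
  by unfold_locales (auto simp: scaleC_add_right scaleC_add_left scaleC_scaleC)

lemma vector_space_complex_mult: "vector_space ((*) :: complex \<Rightarrow> complex \<Rightarrow> complex)"
  by unfold_locales (auto simp: algebra_simps)

lemma complex_linear_iff:
  fixes f :: "'a::complex_vector \<Rightarrow> complex"
  shows "Vector_Spaces.linear scaleC (*) f \<longleftrightarrow>
    (\<forall>x y. f (x + y) = f x + f y) \<and> (\<forall>c x. f (c *\<^sub>C x) = c * f x)"
  by (auto simp: Vector_Spaces.linear_iff vector_space_scaleC vector_space_complex_mult)

lemma scaleC_scaleR: "c *\<^sub>C (r *\<^sub>R x) = r *\<^sub>R (c *\<^sub>C x)"
  by (simp add: scaleC_scaleC flip: scaleC_of_real) (simp add: mult.commute)

lemma scaleC_eq_scaleR: "c *\<^sub>C x = Re c *\<^sub>R x + Im c *\<^sub>R (\<i> *\<^sub>C x)"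
proof -
  have "c *\<^sub>C x = (complex_of_real (Re c) + complex_of_real (Im c) * \<i>) *\<^sub>C x"
    by (metis complex_eq mult.commute)
  then show ?thesis
    by (simp only: scaleC_add_left scaleC_of_real flip: scaleC_scaleC)
qed

lemma i_scaleC_i_scaleC: "\<i> *\<^sub>C (\<i> *\<^sub>C x) = - x"
  using scaleC_of_real[of "- 1" x] by (simp add: scaleC_scaleC)

text \<open>The complexification of a real functional \<open>g\<close> is \<open>f x = g x - \<i> * g (\<i> x)\<close>.\<close>

lemma birkhoff_james_orthogonal_functional:
  fixes a b :: "'a::complex_normed_vector"
  assumes "birkhoff_james_orthogonal a b"
  obtains f where "Vector_Spaces.linear scaleC (*) f" "\<And>x. cmod (f x) \<le> norm x"
    "f a = complex_of_real (norm a)" "f b = 0"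
proof -
  \<comment> \<open>The distance from \<open>x\<close> to the complex line through \<open>b\<close>;
    orthogonality says that it equals \<open>norm a\<close> at \<open>a\<close>.\<close>
  define p where "p = (\<lambda>x. INF l. norm (x + l *\<^sub>C b))"
  have bdd: "bdd_below (range (\<lambda>l. norm (x + l *\<^sub>C b)))" for x
    by (rule bdd_belowI2[of _ 0]) simp
  have p_le: "p x \<le> norm (x + l *\<^sub>C b)" for x l
    unfolding p_def by (rule cINF_lower[OF bdd]) simp
  have "sublinear p"
    unfolding p_def
  proof (rule sublinear_INF[OF _ bdd])
    fix l m x y
    show "\<exists>k\<in>UNIV. norm (x + y + k *\<^sub>C b) \<le> norm (x + l *\<^sub>C b) + norm (y + m *\<^sub>C b)"
      using norm_triangle_ineq[of "x + l *\<^sub>C b" "y + m *\<^sub>C b"]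
      by (intro bexI[of _ "l + m"]) (auto simp: scaleC_add_left algebra_simps)
  next
    fix l x and r :: real assume "0 < r"
    have "r *\<^sub>R x + (complex_of_real r * l) *\<^sub>C b = r *\<^sub>R (x + l *\<^sub>C b)"
      by (simp add: scaleR_add_right scaleC_of_real flip: scaleC_scaleC)
    then show "\<exists>k\<in>UNIV. norm (r *\<^sub>R x + k *\<^sub>C b) \<le> r * norm (x + l *\<^sub>C b)"
      using \<open>0 < r\<close> by (intro bexI[of _ "complex_of_real r * l"]) auto
  qed simp
  then obtain g where g: "linear g" "\<And>x. g x \<le> p x" "g a = p a"
    using hahn_banach_sublinear by blast
  have g_le: "g x \<le> norm x" for x
    using g(2)[of x] p_le[of x 0] norm_scaleC[of 0 b] by simp
  have "norm a \<le> p a"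
    unfolding p_def using assms by (intro cINF_greatest) (auto simp: birkhoff_james_orthogonal_def)
  then have ga: "g a = norm a"
    using g(3) g_le[of a] by simp
  have g_line: "g (c *\<^sub>C b) = 0" for c
  proof -
    \<comment> \<open>\<open>p\<close> is at most zero on the line; the bound for both
      \<open>d\<close> and its negative makes \<open>g\<close> vanish there.\<close>
    have le: "g (d *\<^sub>C b) \<le> 0" for d
      using g(2)[of "d *\<^sub>C b"] p_le[of "d *\<^sub>C b" "- d"] norm_scaleC[of 0 b]
      by (simp flip: scaleC_add_left)
    have "(- c) *\<^sub>C b = - (c *\<^sub>C b)"
      by (simp add: scaleC_eq_scaleR[of "- c"] scaleC_eq_scaleR[of c])
    then show ?thesis
      using le[of c] le[of "- c"] linear_neg[OF g(1), of "c *\<^sub>C b"] by simp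
  qed
  define f where "f = (\<lambda>x. Complex (g x) (- g (\<i> *\<^sub>C x)))"
  have f_add: "f (x + y) = f x + f y" for x y
    by (simp add: f_def complex_eq_iff scaleC_add_right linear_add[OF g(1)])
  have f_scale: "f (c *\<^sub>C x) = c * f x" for c x
    by (simp add: f_def complex_eq_iff scaleC_eq_scaleR[of c x] scaleC_add_right scaleC_scaleR
        i_scaleC_i_scaleC linear_add[OF g(1)] linear_diff[OF g(1)] linear_scale[OF g(1)]
        linear_neg[OF g(1)])
  have f_le: "cmod (f x) \<le> norm x" for x
  proof (cases "f x = 0")
    case False
    \<comment> \<open>Rotation by the unimodular \<open>c\<close> makes
      \<open>f (c *\<^sub>C x)\<close> real and nonnegative, hence equal to its real part
      \<open>g (c *\<^sub>C x)\<close>.\<close>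
    define c where "c = cnj (sgn (f x))"
    have "cmod c = 1"
      using False by (simp add: c_def norm_sgn)
    have "f (c *\<^sub>C x) = complex_of_real (cmod (f x))"
      using False unfolding f_scale c_def
      by (simp add: sgn_eq mult.commute complex_norm_square[symmetric] power2_eq_square field_simps)
    then have "cmod (f x) = g (c *\<^sub>C x)"
      by (simp add: f_def complex_eq_iff)
    also have "\<dots> \<le> norm x"
      using g_le[of "c *\<^sub>C x"] \<open>cmod c = 1\<close> by (simp add: norm_scaleC)
    finally show ?thesis .
  qed simp
  have "Re (f a) = norm a"
    by (simp add: f_def ga)
  \<comment> \<open>The real part already exhausts the bound on \<open>cmod (f a)\<close>, so the
    imaginary part is zero.\<close>
  moreover have "(Re (f a))\<^sup>2 + (Im (f a))\<^sup>2 \<le> (norm a)\<^sup>2"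
    using power_mono[OF f_le[of a], of 2] by (simp add: cmod_power2)
  ultimately have "f a = complex_of_real (norm a)"
    by (simp add: complex_eq_iff)
  moreover have "f b = 0"
    using g_line[of 1] g_line[of \<i>] by (simp add: f_def complex_eq_iff)
  ultimately show thesis
    using that[of f] f_add f_scale f_le by (simp add: complex_linear_iff)
qed

section \<open>The involution, bilinear forms and the equivalence\<close>

lemma norm_star: "norm (star x) = norm (x::'a::cstar_algebra)"
proof -
  \<comment> \<open>By the C*-identity, \<open>norm y\<close> squared is the norm of
    \<open>star y * y\<close>. One inequality suffices, as \<open>star\<close> is its own
    inverse.\<close>
  have le: "norm y \<le> norm (star y)" for y :: 'a
  proof (cases "y = 0")
    case False
    have "norm y * norm y \<le> norm (star y) * norm y"
      using norm_mult_ineq[of "star y" y] by (simp add: cstar_identity power2_eq_square)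
    then show ?thesis using False by simp
  qed simp
  show ?thesis
    using le[of x] le[of "star x"] by (simp add: star_star)
qed

lemma complex_bilinear_bound:
  fixes \<psi> :: "'a::complex_normed_vector \<times> 'a \<Rightarrow> complex"
  assumes "complex_bilinear \<psi>" "bilinear_norm \<psi> \<le> 1"
  shows "cmod (\<psi> (u, v)) \<le> norm u * norm v"
proof -
  have scale: "\<psi> (c *\<^sub>C x, d *\<^sub>C y) = c * d * \<psi> (x, y)" for c d x y
    using assms(1) by (simp add: complex_bilinear_def complex_linear_iff)
  have unit: "cmod (\<psi> (x, y)) \<le> 1" if "norm x \<le> 1" "norm y \<le> 1" for x y
  proof -
    have "ereal (cmod (\<psi> (x, y))) \<le> bilinear_norm \<psi>"
      unfolding bilinear_norm_def using that by (intro SUP_upper2[of "(x, y)"]) auto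
    also note assms(2)
    finally show ?thesis by simp
  qed
  \<comment> \<open>Asking for \<open>norm y \<le> 1\<close> rather than equality lets
    \<open>y = 0\<close> serve for \<open>x = 0\<close>.\<close>
  have normalize: "\<exists>y. norm y \<le> 1 \<and> x = complex_of_real (norm x) *\<^sub>C y" for x :: 'a
    by (cases "x = 0") (auto simp: scaleC_of_real scaleC_eq_scaleR[of 0] intro!: exI[of _ "x /\<^sub>R norm x"])
  obtain x y where "norm x \<le> 1" "u = complex_of_real (norm u) *\<^sub>C x"
    "norm y \<le> 1" "v = complex_of_real (norm v) *\<^sub>C y"
    using normalize by meson
  then have "cmod (\<psi> (u, v)) = norm u * norm v * cmod (\<psi> (x, y))"
    using scale[of "norm u" x "norm v" y] by (simp add: norm_mult)
  also have "\<dots> \<le> norm u * norm v * 1"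
    using unit[OF \<open>norm x \<le> 1\<close> \<open>norm y \<le> 1\<close>] by (intro mult_left_mono) auto
  finally show ?thesis by simp
qed

theorem corollary2p2:
  fixes a b :: "'a::cstar_algebra"
  assumes "a \<noteq> 0"
  shows "birkhoff_james_orthogonal a b \<longleftrightarrow>
    (\<exists>\<psi> :: 'a \<times> 'a \<Rightarrow> complex. complex_bilinear \<psi> \<and> bilinear_norm \<psi> = 1 \<and>
       \<psi> (a, star a) = complex_of_real ((norm a)\<^sup>2) \<and> \<psi> (a, star b) = 0)"
proof
  assume "birkhoff_james_orthogonal a b"
  then obtain f where lin: "Vector_Spaces.linear scaleC (*) f" and le: "\<And>x. cmod (f x) \<le> norm x"
    and fa: "f a = complex_of_real (norm a)" and fb: "f b = 0"
    using birkhoff_james_orthogonal_functional by blast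
  have f_add: "f (x + y) = f x + f y" and f_scale: "f (c *\<^sub>C x) = c * f x" for x y c
    using lin by (auto simp: complex_linear_iff)
  \<comment> \<open>The outer conjugation cancels the conjugate-linearity of \<open>star\<close>, so
    the form is complex-linear in \<open>v\<close>.\<close>
  define \<psi> where "\<psi> = (\<lambda>(u, v). f u * cnj (f (star v)))"
  have "complex_bilinear \<psi>"
    by (simp add: complex_bilinear_def complex_linear_iff \<psi>_def f_add f_scale star_add star_scaleC
        algebra_simps)
  moreover have "bilinear_norm \<psi> = 1"
  proof (rule antisym)
    have "cmod (\<psi> (u, v)) \<le> 1" if "norm u \<le> 1" "norm v \<le> 1" for u v
      using le[of u] le[of "star v"] that
        mult_mono[of "cmod (f u)" 1 "cmod (f (star v))" 1]
      by (simp add: \<psi>_def norm_mult norm_star)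
    then show "bilinear_norm \<psi> \<le> 1"
      unfolding bilinear_norm_def by (intro SUP_least) auto
    \<comment> \<open>The norm is attained at the pair of \<open>e\<close> and
      \<open>star e\<close>, where the form takes the value
      \<open>f e * cnj (f e) = 1\<close>.\<close>
    define e where "e = complex_of_real (inverse (norm a)) *\<^sub>C a"
    have "norm e = 1"
      using assms by (simp add: e_def norm_scaleC norm_inverse)
    moreover have "f e = 1"
      using assms by (simp add: e_def f_scale fa)
    ultimately show "1 \<le> bilinear_norm \<psi>"
      unfolding bilinear_norm_def
      by (intro SUP_upper2[of "(e, star e)"]) (auto simp: \<psi>_def norm_star star_star)
  qed
  moreover have "\<psi> (a, star a) = complex_of_real ((norm a)\<^sup>2)" "\<psi> (a, star b) = 0"
    by (simp_all add: \<psi>_def star_star fa fb power2_eq_square)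
  ultimately show "\<exists>\<psi>. complex_bilinear \<psi> \<and> bilinear_norm \<psi> = 1 \<and>
       \<psi> (a, star a) = complex_of_real ((norm a)\<^sup>2) \<and> \<psi> (a, star b) = 0"
    by blast
next
  assume "\<exists>\<psi>. complex_bilinear \<psi> \<and> bilinear_norm \<psi> = 1 \<and>
       \<psi> (a, star a) = complex_of_real ((norm a)\<^sup>2) \<and> \<psi> (a, star b) = 0"
  then obtain \<psi> :: "'a \<times> 'a \<Rightarrow> complex" where \<psi>: "complex_bilinear \<psi>" "bilinear_norm \<psi> = 1"
    "\<psi> (a, star a) = complex_of_real ((norm a)\<^sup>2)" "\<psi> (a, star b) = 0"
    by blast
  show "birkhoff_james_orthogonal a b"
    unfolding birkhoff_james_orthogonal_def
  proof
    fix l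
    \<comment> \<open>The adjoint contributes \<open>cnj l *\<^sub>C star b\<close>, which is
      annihilated for every \<open>l\<close> because the form vanishes at
      \<open>(a, star b)\<close>.\<close>
    have "\<psi> (a, star (a + l *\<^sub>C b)) = complex_of_real ((norm a)\<^sup>2)"
      using \<psi> by (simp add: complex_bilinear_def complex_linear_iff star_add star_scaleC)
    then have "(norm a)\<^sup>2 \<le> norm a * norm (a + l *\<^sub>C b)"
      using complex_bilinear_bound[OF \<psi>(1), of a "star (a + l *\<^sub>C b)"] \<psi>(2)
      by (simp add: norm_star norm_power)
    then show "norm a \<le> norm (a + l *\<^sub>C b)"
      using assms by (simp add: power2_eq_square)
  qed
qed

end
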